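(* Let $d\geq2$, let $\mathcal{A}\subseteq\mathbb{R}^m$ be open, suppose $(\alpha,x)\mapsto\varphi_\alpha(x)\in\mathbb{R}$ is jointly $C^2$ on $\mathcal{A}\times\mathbb{R}^d$, and fix a tuple $\boldsymbol{\alpha}^0=(\alpha_1^0,\ldots,\alpha_d^0)\in\mathcal{A}^d$. Let $K\subset U\subseteq\mathbb{R}^d$, where $K$ is compact and $U$ is open, and suppose that $\mathsf{H}_{\boldsymbol{\alpha}^0}$ is fold non-degenerate at every critical point in $\overline{U}$. Then there are open neighbourhoods $\alpha_j^0\in U_j\subseteq\mathcal{A}$, $j=1,\ldots,d$, depending only on $\boldsymbol{\alpha}^0$ and $K$, with the following property: for every Borel $1$-rectifiable set $E\subseteq K$ satisfying $\mathcal{H}^1(E)>0$, there is an index $j_E\in\{1,\ldots,d\}$ (which may depend on $E$) such that $$\mathcal{H}^1\big(\varphi_\alpha(E)\big)>0\qquad\text{for every }\alpha\in U_{j_E}.$$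
   Context: $\mathcal{H}^1$ is $1$-dimensional Hausdorff measure. A Borel set $E\subseteq\mathbb{R}^d$ is $1$-rectifiable if there are Lipschitz maps $f_j:\mathbb{R}\to\mathbb{R}^d$, $j\in\mathbb{N}$, with $\mathcal{H}^1(E\setminus\bigcup_j f_j(\mathbb{R}))=0$. For $\boldsymbol{\alpha}=(\alpha_1,\ldots,\alpha_d)\in\mathcal{A}^d$ the canonical encoding map is $\mathsf{H}_{\boldsymbol{\alpha}}(x)=(\varphi_{\alpha_1}(x),\ldots,\varphi_{\alpha_d}(x))$; its spatial derivative is $D_x\mathsf{H}_{\boldsymbol{\alpha}}(x)$; $J_{\boldsymbol{\alpha}}(x)=\det D_x\mathsf{H}_{\boldsymbol{\alpha}}(x)$; a critical point is a point of $\Sigma_{\boldsymbol{\alpha}}=\{x\in\mathbb{R}^d:\operatorname{rank}D_x\mathsf{H}_{\boldsymbol{\alpha}}(x)\leq d-1\}$. The map $\mathsf{H}_{\boldsymbol{\alpha}}$ is fold non-degenerate at a critical point $x$ if both (1) $\operatorname{rank}D_x\mathsf{H}_{\boldsymbol{\alpha}}(x)=d-1$ and (2) $D_xJ_{\boldsymbol{\alpha}}(x)[v]\neq0$ for every $v\in\ker D_x\mathsf{H}_{\boldsymbol{\alpha}}(x)\setminus\{0\}$. *)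

theory Defs
  imports "HOL-Analysis.Analysis"
begin

text \<open>
  One-dimensional Hausdorff outer measure, defined on all subsets of a metric space. No
  measurability of the argument is required, since a continuous image of a Borel set need not be
  Borel. The covering sets are required to be bounded because \<^const>\<open>diameter\<close> is
  unspecified on unbounded sets.
\<close>

definition hausdorff1_pre :: "real \<Rightarrow> 'a::metric_space set \<Rightarrow> ennreal" where
  "hausdorff1_pre \<delta> S =
     (INF C \<in> {C :: nat \<Rightarrow> 'a set. S \<subseteq> (\<Union>i. C i) \<and> (\<forall>i. bounded (C i) \<and> diameter (C i) \<le> \<delta>)}.
        \<Sum>i. ennreal (diameter (C i)))"

definition hausdorff1 :: "'a::metric_space set \<Rightarrow> ennreal" where
  "hausdorff1 S = (SUP \<delta> \<in> {0<..}. hausdorff1_pre \<delta> S)"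

definition rectifiable1 :: "'a::metric_space set \<Rightarrow> bool" where
  "rectifiable1 E \<longleftrightarrow>
     E \<in> sets borel \<and>
     (\<exists>f :: nat \<Rightarrow> real \<Rightarrow> 'a.
        (\<forall>j. \<exists>L. L-lipschitz_on UNIV (f j)) \<and> hausdorff1 (E - (\<Union>j. range (f j))) = 0)"

text \<open>Continuous differentiability, to be used on open sets \<open>S\<close>.\<close>

definition C1_on :: "('a::real_normed_vector \<Rightarrow> 'b::real_normed_vector) \<Rightarrow> 'a set \<Rightarrow> bool" where
  "C1_on f S \<longleftrightarrow>
     (\<exists>f' :: 'a \<Rightarrow> 'a \<Rightarrow>\<^sub>L 'b.
        (\<forall>x\<in>S. (f has_derivative blinfun_apply (f' x)) (at x)) \<and> continuous_on S f')"

definition C2_on :: "('a::real_normed_vector \<Rightarrow> 'b::real_normed_vector) \<Rightarrow> 'a set \<Rightarrow> bool" where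
  "C2_on f S \<longleftrightarrow>
     (\<exists>f' :: 'a \<Rightarrow> 'a \<Rightarrow>\<^sub>L 'b.
        (\<forall>x\<in>S. (f has_derivative blinfun_apply (f' x)) (at x)) \<and> C1_on f' S)"

definition encoding_map :: "('p \<Rightarrow> real^'d \<Rightarrow> real) \<Rightarrow> ('d \<Rightarrow> 'p) \<Rightarrow> real^'d \<Rightarrow> real^'d" where
  "encoding_map \<phi> \<alpha> x = (\<chi> j. \<phi> (\<alpha> j) x)"

definition jacobian_det :: "(real^'d \<Rightarrow> real^'d) \<Rightarrow> real^'d \<Rightarrow> real" where
  "jacobian_det H x = det (jacobian H (at x))"

definition critical_set :: "(real^'d \<Rightarrow> real^'d) \<Rightarrow> (real^'d) set" where
  "critical_set H = {x. rank (jacobian H (at x)) \<le> CARD('d) - 1}"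

definition fold_nondegenerate_at :: "(real^'d \<Rightarrow> real^'d) \<Rightarrow> real^'d \<Rightarrow> bool" where
  "fold_nondegenerate_at H x \<longleftrightarrow>
     rank (jacobian H (at x)) = CARD('d) - 1 \<and>
     (\<forall>v. jacobian H (at x) *v v = 0 \<and> v \<noteq> 0 \<longrightarrow> frechet_derivative (jacobian_det H) (at x) v \<noteq> 0)"

end

theory Submission
  imports Defs
begin

text \<open>
  Write \<open>H\<^sub>p\<close> for the encoding map of a tuple \<open>p\<close> of parameters and \<open>J\<^sub>p\<close> for its Jacobian determinant.
  Fold non-degeneracy of \<open>H\<^sub>p\<close> on \<open>K\<close> says that \<open>\<bar>DH\<^sub>p(x) v\<bar> + \<bar>DJ\<^sub>p(x) v\<bar> > 0\<close> for \<open>x \<in> K\<close> and unit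
  vectors \<open>v\<close>. By compactness it persists for all tuples in a product of neighbourhoods \<open>V\<^sub>j\<close> of the
  \<open>\<alpha>\<^sub>j\<^sup>0\<close>. If no index worked for \<open>E\<close>, each \<open>V\<^sub>j\<close> would contain some \<open>\<alpha>\<^sub>j\<close> for which
  \<open>\<phi>\<^bsub>\<alpha>\<^sub>j\<^esub>(E)\<close> is null; for the tuple \<open>p\<close> of these, every coordinate projection of \<open>H\<^sub>p(E)\<close> is null.

  Now \<open>H\<^sub>p\<close> is locally bi-Lipschitz off \<open>{J\<^sub>p = 0}\<close>, and also on \<open>{J\<^sub>p = 0}\<close>, because \<open>(H\<^sub>p, J\<^sub>p)\<close> is an
  immersion there. So it suffices that a set \<open>g(T)\<close> on a Lipschitz curve \<open>g\<close> is null once all its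
  coordinate projections are. The Banach indicatrix of a Lipschitz function \<open>g\<^sub>j\<close> is integrable, so
  \<open>g\<^sub>j\<close> has small total variation on the preimage of a small neighbourhood of the null set \<open>g\<^sub>j(T)\<close>;
  hence the curve is short on a neighbourhood of \<open>T\<close>. No differentiability almost everywhere is used.
\<close>

section \<open>Sets of vanishing one-dimensional Hausdorff measure\<close>

lemma hausdorff1_eq_0_iff:
  fixes S :: "'a::metric_space set"
  shows "hausdorff1 S = 0 \<longleftrightarrow>
    (\<forall>e>0. \<exists>C :: nat \<Rightarrow> 'a set. S \<subseteq> (\<Union>i. C i) \<and> (\<forall>i. bounded (C i)) \<and>
       (\<forall>F. finite F \<longrightarrow> (\<Sum>i\<in>F. diameter (C i)) \<le> e))" (is "_ \<longleftrightarrow> (\<forall>e>0. ?R e)")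
proof
  assume S: "hausdorff1 S = 0"
  show "\<forall>e>0. ?R e"
  proof (intro allI impI)
    fix e :: real assume e: "e > 0"
    have "hausdorff1_pre 1 S \<le> hausdorff1 S"
      unfolding hausdorff1_def by (rule SUP_upper) simp
    then have "hausdorff1_pre 1 S < ennreal e"
      using S e by simp
    then obtain C :: "nat \<Rightarrow> 'a set" where C: "S \<subseteq> (\<Union>i. C i)" "\<forall>i. bounded (C i)"
      "(\<Sum>i. ennreal (diameter (C i))) < ennreal e"
      unfolding hausdorff1_pre_def INF_less_iff by auto
    have "(\<Sum>i\<in>F. diameter (C i)) \<le> e" if "finite F" for F
    proof -
      have "ennreal (\<Sum>i\<in>F. diameter (C i)) = (\<Sum>i\<in>F. ennreal (diameter (C i)))"
        using C(2) by (simp add: diameter_ge_0)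
      also have "\<dots> \<le> (\<Sum>i. ennreal (diameter (C i)))"
        by (rule sum_le_suminf) (use that in auto)
      also have "\<dots> \<le> ennreal e" using C(3) by (rule less_imp_le)
      finally show ?thesis
        using e by (simp add: ennreal_le_iff)
    qed
    then show "?R e" using C by blast
  qed
next
  assume R: "\<forall>e>0. ?R e"
  have "hausdorff1_pre \<delta> S \<le> ennreal e" if "\<delta> > 0" "e > 0" for \<delta> e
  proof -
    have "min \<delta> e > 0" using that by simp
    with R obtain C :: "nat \<Rightarrow> 'a set" where C: "S \<subseteq> (\<Union>i. C i)" "\<forall>i. bounded (C i)"
      and s: "\<And>F. finite F \<Longrightarrow> (\<Sum>i\<in>F. diameter (C i)) \<le> min \<delta> e" by metis
    have "diameter (C i) \<le> \<delta>" for i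
      using s[of "{i}"] by simp
    then have "hausdorff1_pre \<delta> S \<le> (\<Sum>i. ennreal (diameter (C i)))"
      unfolding hausdorff1_pre_def using C by (intro INF_lower) auto
    also have "\<dots> \<le> ennreal e"
    proof (rule suminf_le_const)
      fix n
      have "(\<Sum>i<n. ennreal (diameter (C i))) = ennreal (\<Sum>i<n. diameter (C i))"
        using C(2) by (simp add: diameter_ge_0)
      also have "\<dots> \<le> ennreal e"
        using s[of "{..<n}"] by (intro ennreal_leI) simp
      finally show "(\<Sum>i<n. ennreal (diameter (C i))) \<le> ennreal e" .
    qed simp
    finally show ?thesis .
  qed
  \<comment> \<open>The summand \<open>0\<close> gives the bound the shape expected by
    \<open>ennreal_le_epsilon\<close>.\<close>
  then have "hausdorff1_pre \<delta> S \<le> 0 + ennreal e" if "\<delta> > 0" "e > 0" for \<delta> e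
    unfolding add_0_left using that by blast
  then have "hausdorff1_pre \<delta> S \<le> 0" if "\<delta> > 0" for \<delta>
    using that by (metis ennreal_le_epsilon)
  then have "hausdorff1 S \<le> 0"
    unfolding hausdorff1_def by (intro SUP_least) auto
  then show "hausdorff1 S = 0"
    by simp
qed

text \<open>Later covers are indexed by pairs of naturals or by the components of an open set; an
  enumeration turns them into the sequences of the definition.\<close>

lemma hausdorff1_eq_0I:
  fixes S :: "'a::metric_space set"
  assumes "\<And>e. e > 0 \<Longrightarrow> \<exists>(I :: 'i set) C. countable I \<and> S \<subseteq> (\<Union>i\<in>I. C i) \<and>
    (\<forall>i\<in>I. bounded (C i)) \<and> (\<forall>F. finite F \<and> F \<subseteq> I \<longrightarrow> (\<Sum>i\<in>F. diameter (C i)) \<le> e)"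
  shows "hausdorff1 S = 0"
  unfolding hausdorff1_eq_0_iff
proof (intro allI impI)
  fix e :: real assume "e > 0"
  with assms obtain I :: "'i set" and C where I: "countable I" and S: "S \<subseteq> (\<Union>i\<in>I. C i)"
    and b: "\<And>i. i \<in> I \<Longrightarrow> bounded (C i)"
    and s: "\<And>F. finite F \<Longrightarrow> F \<subseteq> I \<Longrightarrow> (\<Sum>i\<in>F. diameter (C i)) \<le> e" by metis
  define N where "N = to_nat_on I ` I"
  \<comment> \<open>Off \<open>N\<close>, \<open>from_nat_into I\<close> only returns a default
    value; padding with \<open>{}\<close> instead contributes diameter 0.\<close>
  define D where "D n = (if n \<in> N then C (from_nat_into I n) else {})" for n
  have from_to: "from_nat_into I (to_nat_on I i) = i" if "i \<in> I" for i
    using I that by simp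
  show "\<exists>C :: nat \<Rightarrow> 'a set. S \<subseteq> (\<Union>i. C i) \<and> (\<forall>i. bounded (C i)) \<and>
       (\<forall>F. finite F \<longrightarrow> (\<Sum>i\<in>F. diameter (C i)) \<le> e)"
  proof (intro exI[of _ D] conjI allI impI)
    show "S \<subseteq> (\<Union>n. D n)"
    proof
      fix x assume "x \<in> S"
      then obtain i where "i \<in> I" "x \<in> C i" using S by auto
      then have "x \<in> D (to_nat_on I i)" by (simp add: D_def N_def from_to)
      then show "x \<in> (\<Union>n. D n)" by blast
    qed
    show "bounded (D n)" for n
      unfolding D_def N_def using b from_to by auto
    fix F :: "nat set" assume F: "finite F"
    have inj: "inj_on (from_nat_into I) (F \<inter> N)"
      unfolding N_def by (rule inj_onI) (auto simp: from_to)
    have "(\<Sum>n\<in>F. diameter (D n)) = (\<Sum>n\<in>F \<inter> N. diameter (C (from_nat_into I n)))"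
      using F by (simp add: D_def sum.inter_restrict if_distrib cong: if_cong)
    also have "\<dots> = (\<Sum>i\<in>from_nat_into I ` (F \<inter> N). diameter (C i))"
      by (simp add: sum.reindex[OF inj])
    also have "\<dots> \<le> e"
      by (rule s) (use F in \<open>auto simp: N_def from_to\<close>)
    finally show "(\<Sum>n\<in>F. diameter (D n)) \<le> e" .
  qed
qed

lemma hausdorff1_eq_0_subset:
  assumes "hausdorff1 T = 0" "S \<subseteq> T"
  shows "hausdorff1 S = 0"
  using assms unfolding hausdorff1_eq_0_iff by (meson order_trans)

lemma hausdorff1_eq_0_UN:
  fixes S :: "'i \<Rightarrow> 'a::metric_space set"
  assumes I: "countable I" and S: "\<And>i. i \<in> I \<Longrightarrow> hausdorff1 (S i) = 0"
  shows "hausdorff1 (\<Union>i\<in>I. S i) = 0"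
proof -
  \<comment> \<open>The family is first turned into a sequence, so that its \<open>n\<close>-th
    member can be covered with total diameter \<open>e / 2 ^ Suc n\<close>. The combined cover is
    indexed by pairs.\<close>
  have "hausdorff1 (\<Union>n. if n \<in> to_nat_on I ` I then S (from_nat_into I n) else {}) = 0"
    (is "hausdorff1 (\<Union>n. ?T n) = 0")
  proof (rule hausdorff1_eq_0I[where 'i = "nat \<times> nat"])
    fix e :: real assume e: "e > 0"
    have T: "hausdorff1 (?T n) = 0" for n
    proof (cases "n \<in> to_nat_on I ` I")
      case True
      then show ?thesis using S I by auto
    next
      case False
      then show ?thesis by (auto simp: hausdorff1_eq_0_iff intro!: exI[of _ "\<lambda>_. {}"])
    qed
    have "\<exists>C :: nat \<Rightarrow> 'a set. ?T n \<subseteq> (\<Union>i. C i) \<and> (\<forall>i. bounded (C i)) \<and>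
       (\<forall>F. finite F \<longrightarrow> (\<Sum>i\<in>F. diameter (C i)) \<le> e / 2 ^ Suc n)" for n
      using T[of n, unfolded hausdorff1_eq_0_iff, rule_format, of "e / 2 ^ Suc n"] e by simp
    then obtain C :: "nat \<Rightarrow> nat \<Rightarrow> 'a set" where C: "\<And>n. ?T n \<subseteq> (\<Union>i. C n i)"
      "\<And>n i. bounded (C n i)"
      "\<And>n F. finite F \<Longrightarrow> (\<Sum>i\<in>F. diameter (C n i)) \<le> e / 2 ^ Suc n" by metis
    have geo: "(\<Sum>n\<in>F. e / 2 ^ Suc n) \<le> e" if "finite F" for F :: "nat set"
    proof -
      have "(\<lambda>n. e * (1 / 2) ^ Suc n) sums (e * 1)"
        by (intro sums_mult power_half_series)
      then have "(\<lambda>n. e / 2 ^ Suc n) sums e"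
        by (simp add: power_one_over)
      then show ?thesis
        using sum_le_suminf[of "\<lambda>n. e / 2 ^ Suc n" F] that e by (simp add: sums_iff)
    qed
    have "(\<Sum>p\<in>F. diameter (case p of (n, i) \<Rightarrow> C n i)) \<le> e" if F: "finite F" for F
    proof -
      \<comment> \<open>A finite set of pairs is enlarged to the product of its projections, which
        can be summed row by row.\<close>
      have "(\<Sum>p\<in>F. diameter (case p of (n, i) \<Rightarrow> C n i))
          \<le> (\<Sum>p\<in>fst ` F \<times> snd ` F. diameter (case p of (n, i) \<Rightarrow> C n i))"
        using F C(2) by (intro sum_mono2) (auto simp: diameter_ge_0 intro: rev_image_eqI)
      also have "\<dots> = (\<Sum>n\<in>fst ` F. \<Sum>i\<in>snd ` F. diameter (C n i))"
        by (subst sum.cartesian_product) (simp add: case_prod_beta)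
      also have "\<dots> \<le> (\<Sum>n\<in>fst ` F. e / 2 ^ Suc n)"
        using F by (intro sum_mono C) auto
      also have "\<dots> \<le> e" using F by (intro geo) auto
      finally show ?thesis .
    qed
    moreover have "(\<Union>n. ?T n) \<subseteq> (\<Union>p\<in>UNIV. case p of (n, i) \<Rightarrow> C n i)"
    proof
      fix x assume "x \<in> (\<Union>n. ?T n)"
      then obtain n where "x \<in> ?T n" by blast
      then obtain i where "x \<in> C n i" using C(1) by blast
      then have "x \<in> (case (n, i) of (n, i) \<Rightarrow> C n i)" by simp
      then show "x \<in> (\<Union>p\<in>UNIV. case p of (n, i) \<Rightarrow> C n i)" by blast
    qed
    ultimately show "\<exists>(I :: (nat \<times> nat) set) D. countable I \<and> (\<Union>n. ?T n) \<subseteq> (\<Union>i\<in>I. D i) \<and>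
      (\<forall>i\<in>I. bounded (D i)) \<and> (\<forall>F. finite F \<and> F \<subseteq> I \<longrightarrow> (\<Sum>i\<in>F. diameter (D i)) \<le> e)"
      using C(2) by (intro exI[of _ UNIV] exI[of _ "\<lambda>(n, i). C n i"]) auto
  qed
  moreover have "(\<Union>i\<in>I. S i) \<subseteq> (\<Union>n. ?T n)"
  proof
    fix x assume "x \<in> (\<Union>i\<in>I. S i)"
    then obtain i where "i \<in> I" "x \<in> S i" by blast
    then have "x \<in> ?T (to_nat_on I i)" using I by simp
    then show "x \<in> (\<Union>n. ?T n)" by blast
  qed
  ultimately show ?thesis
    by (rule hausdorff1_eq_0_subset)
qed

lemma hausdorff1_eq_0_Un:
  fixes S T :: "'a::metric_space set"
  assumes "hausdorff1 S = 0" "hausdorff1 T = 0"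
  shows "hausdorff1 (S \<union> T) = 0"
  using hausdorff1_eq_0_UN[of "{S, T}" "\<lambda>X. X"] assms by auto

lemma hausdorff1_lipschitz_image_eq_0:
  fixes f :: "'a::metric_space \<Rightarrow> 'b::metric_space"
  assumes S: "hausdorff1 S = 0" and f: "L-lipschitz_on S f"
  shows "hausdorff1 (f ` S) = 0"
  unfolding hausdorff1_eq_0_iff
proof (intro allI impI)
  fix e :: real assume e: "e > 0"
  have L: "L \<ge> 0" using f lipschitz_on_nonneg by blast
  \<comment> \<open>\<open>L + 1\<close> rather than \<open>L\<close>, because \<open>L\<close> may
    be 0.\<close>
  then have "e / (L + 1) > 0" using e by simp
  with S obtain C :: "nat \<Rightarrow> 'a set" where C: "S \<subseteq> (\<Union>i. C i)" "\<forall>i. bounded (C i)"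
      and s: "\<And>F. finite F \<Longrightarrow> (\<Sum>i\<in>F. diameter (C i)) \<le> e / (L + 1)"
    unfolding hausdorff1_eq_0_iff by metis
  \<comment> \<open>\<open>f\<close> is controlled on \<open>S\<close> only, so the covering sets
    are cut down to \<open>S\<close> before being mapped.\<close>
  have d: "dist (f x) (f y) \<le> L * diameter (C i)" if "x \<in> C i \<inter> S" "y \<in> C i \<inter> S" for x y i
  proof -
    have "dist (f x) (f y) \<le> L * dist x y" using f that by (auto simp: lipschitz_on_def)
    also have "\<dots> \<le> L * diameter (C i)"
      using that C(2) L by (intro mult_left_mono diameter_bounded_bound) auto
    finally show ?thesis .
  qed
  have b: "bounded (f ` (C i \<inter> S))" for i
    using d unfolding bounded_two_points by blast
  have D: "diameter (f ` (C i \<inter> S)) \<le> L * diameter (C i)" for i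
    unfolding diameter_def[of "f ` _"]
    using d L C(2) diameter_ge_0[of "C i"] by (auto intro!: cSUP_least)
  have "(\<Sum>i\<in>F. diameter (f ` (C i \<inter> S))) \<le> e" if "finite F" for F
  proof -
    have "(\<Sum>i\<in>F. diameter (f ` (C i \<inter> S))) \<le> L * (\<Sum>i\<in>F. diameter (C i))"
      unfolding sum_distrib_left by (intro sum_mono D)
    also have "\<dots> \<le> L * (e / (L + 1))" using s[OF that] L by (rule mult_left_mono)
    also have "\<dots> \<le> e" using L e by (simp add: field_simps)
    finally show ?thesis .
  qed
  then show "\<exists>C :: nat \<Rightarrow> 'b set. f ` S \<subseteq> (\<Union>i. C i) \<and> (\<forall>i. bounded (C i)) \<and>
       (\<forall>F. finite F \<longrightarrow> (\<Sum>i\<in>F. diameter (C i)) \<le> e)"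
  proof (intro exI[of _ "\<lambda>i. f ` (C i \<inter> S)"] conjI allI impI)
    show "f ` S \<subseteq> (\<Union>i. f ` (C i \<inter> S))" using C(1) by blast
  qed (use b in auto)
qed

text \<open>By Lindelof, countably many of the good open sets already cover
  \<open>S\<close>.\<close>

lemma hausdorff1_eq_0_locally:
  fixes S :: "'a::{metric_space, second_countable_topology} set"
  assumes "\<And>x. x \<in> S \<Longrightarrow> \<exists>W. open W \<and> x \<in> W \<and> hausdorff1 (S \<inter> W) = 0"
  shows "hausdorff1 S = 0"
proof -
  let ?F = "{W. open W \<and> hausdorff1 (S \<inter> W) = 0}"
  obtain F where F: "F \<subseteq> ?F" "countable F" "\<Union>F = \<Union>?F"
    using Lindelof[of ?F] by blast
  have "hausdorff1 (\<Union>W\<in>F. S \<inter> W) = 0"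
    by (rule hausdorff1_eq_0_UN) (use F in auto)
  moreover have "S \<subseteq> (\<Union>W\<in>F. S \<inter> W)"
    using assms F(3) by blast
  ultimately show ?thesis
    by (rule hausdorff1_eq_0_subset)
qed

text \<open>Link to Lebesgue measure: sets of small total diameter lie in intervals of small total
  length, and intersecting such covers gives a Borel null superset. A superset is asked for because
  \<open>S\<close> itself may fail to be Borel.\<close>

lemma hausdorff1_eq_0_imp_null:
  fixes S :: "real set"
  assumes "hausdorff1 S = 0"
  shows "\<exists>B \<in> null_sets lborel. S \<subseteq> B"
proof -
  have "\<exists>B\<in>sets lborel. S \<subseteq> B \<and> emeasure lborel B \<le> ennreal e" if e: "e > 0" for e
  proof -
    have "e / 2 > 0" using e by simp
    with assms obtain C :: "nat \<Rightarrow> real set" where C: "S \<subseteq> (\<Union>i. C i)" "\<forall>i. bounded (C i)"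
      and s: "\<And>F. finite F \<Longrightarrow> (\<Sum>i\<in>F. diameter (C i)) \<le> e / 2"
      unfolding hausdorff1_eq_0_iff by metis
    \<comment> \<open>If \<open>C i\<close> is empty, \<open>a i\<close> is arbitrary and the
      inclusion below is vacuous. The interval about \<open>a i\<close> has length
      \<open>2 * diameter (C i)\<close>, hence the tolerance \<open>e / 2\<close> above.\<close>
    define a where "a i = (SOME x. x \<in> C i)" for i
    have a: "C i \<subseteq> {a i - diameter (C i)..a i + diameter (C i)}" for i
    proof
      fix x assume x: "x \<in> C i"
      then have "a i \<in> C i" unfolding a_def by (metis someI)
      then have "dist x (a i) \<le> diameter (C i)"
        using x C(2) by (intro diameter_bounded_bound) auto
      then show "x \<in> {a i - diameter (C i)..a i + diameter (C i)}"
        by (auto simp: dist_real_def)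
    qed
    let ?B = "\<Union>i. {a i - diameter (C i)..a i + diameter (C i)}"
    have "emeasure lborel ?B
        \<le> (\<Sum>i. emeasure lborel {a i - diameter (C i)..a i + diameter (C i)})"
      by (rule emeasure_subadditive_countably) auto
    also have "\<dots> \<le> ennreal e"
    proof (rule suminf_le_const)
      fix n
      have "(\<Sum>i<n. emeasure lborel {a i - diameter (C i)..a i + diameter (C i)})
         = (\<Sum>i<n. ennreal (2 * diameter (C i)))"
        using C(2) by (intro sum.cong) (auto simp: diameter_ge_0)
      also have "\<dots> = ennreal (2 * (\<Sum>i<n. diameter (C i)))"
        using C(2) by (subst sum_ennreal) (auto simp: diameter_ge_0 sum_distrib_left)
      also have "\<dots> \<le> ennreal e"
        using s[of "{..<n}"] by (intro ennreal_leI) simp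
      finally show "(\<Sum>i<n. emeasure lborel {a i - diameter (C i)..a i + diameter (C i)})
        \<le> ennreal e" .
    qed simp
    finally show ?thesis using C(1) a by (intro bexI[of _ ?B]) (blast, simp)
  qed
  then have "\<forall>n. \<exists>B\<in>sets lborel. S \<subseteq> B \<and> emeasure lborel B \<le> ennreal (inverse (real (Suc n)))"
    by (meson inverse_positive_iff_positive of_nat_0_less_iff zero_less_Suc)
  then obtain B where B: "\<And>n. B n \<in> sets lborel" "\<And>n. S \<subseteq> B n"
      "\<And>n. emeasure lborel (B n) \<le> ennreal (inverse (real (Suc n)))"
    by metis
  have "emeasure lborel (\<Inter>n. B n) \<le> ennreal (inverse (real (Suc n)))" for n
    using B(3)[of n] B(1) by (meson INT_lower UNIV_I emeasure_mono order_trans)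
  moreover have "(\<lambda>n. ennreal (inverse (real (Suc n)))) \<longlonglongrightarrow> ennreal 0"
    by (intro tendsto_ennrealI LIMSEQ_inverse_real_of_nat)
  ultimately have "emeasure lborel (\<Inter>n. B n) \<le> ennreal 0"
    by (intro LIMSEQ_le_const) auto
  then show ?thesis
    using B(1,2) by (intro bexI[of _ "\<Inter>n. B n"]) (auto simp: null_sets_def)
qed

section \<open>Lipschitz curves with null projections\<close>

text \<open>Once \<open>n\<close> times the smallest gap is at least 1, the scaled points are at
  least 1 apart, so their floors differ. Counting cells of mesh \<open>1/n\<close> then detects
  every point of a finite fibre.\<close>

lemma finite_points_in_distinct_cells:
  fixes P :: "real set"
  assumes "finite P"
  shows "\<forall>\<^sub>F n in sequentially. inj_on (\<lambda>t. \<lfloor>t * real n\<rfloor>) P"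
proof -
  have "\<forall>\<^sub>F n in sequentially. s < t \<longrightarrow> \<lfloor>s * real n\<rfloor> < \<lfloor>t * real n\<rfloor>" for s t :: real
  proof (cases "s < t")
    case True
    obtain N :: nat where N: "N \<ge> 1" "1 / (t - s) \<le> real N"
      by (metis max.cobounded1 max.cobounded2 of_nat_mono order_trans real_arch_simple)
    have "\<lfloor>s * real n\<rfloor> < \<lfloor>t * real n\<rfloor>" if "n \<ge> N" for n
    proof -
      have "1 / (t - s) \<le> real n" using N that by linarith
      then have "s * real n + 1 \<le> t * real n"
        using True by (simp add: field_simps)
      then show ?thesis by linarith
    qed
    then show ?thesis unfolding eventually_sequentially by blast
  qed simp
  then have "\<forall>\<^sub>F n in sequentially. \<forall>s\<in>P. \<forall>t\<in>P. s < t \<longrightarrow> \<lfloor>s * real n\<rfloor> < \<lfloor>t * real n\<rfloor>"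
    using assms by (intro eventually_ball_finite ballI) auto
  then show ?thesis
  proof (rule eventually_mono)
    fix n assume *: "\<forall>s\<in>P. \<forall>t\<in>P. s < t \<longrightarrow> \<lfloor>s * real n\<rfloor> < \<lfloor>t * real n\<rfloor>"
    show "inj_on (\<lambda>t. \<lfloor>t * real n\<rfloor>) P"
    proof (rule inj_onI, rule ccontr)
      fix s t assume "s \<in> P" "t \<in> P" "\<lfloor>s * real n\<rfloor> = \<lfloor>t * real n\<rfloor>" "s \<noteq> t"
      then show False using * by (metis less_irrefl linorder_neqE)
    qed
  qed
qed

text \<open>
  \<open>M\<close> dominates the Banach indicatrix of \<open>g\<close>. It is the lower limit of the number of mesh \<open>1/n\<close> cells
  whose image contains \<open>y\<close>, and is integrable by Fatou's lemma since such an image has length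
  \<open>O(1/n)\<close>.
\<close>

lemma indicatrix_majorant:
  fixes g :: "real \<Rightarrow> real" and R :: nat
  assumes g: "L-lipschitz_on {- real R..real R + 1} g"
  obtains M :: "real \<Rightarrow> ennreal" where "M \<in> borel_measurable borel"
    "(\<integral>\<^sup>+y. M y \<partial>lborel) < \<infinity>"
    "\<And>P y. finite P \<Longrightarrow> P \<subseteq> {- real R<..<real R} \<Longrightarrow> (\<And>t. t \<in> P \<Longrightarrow> g t = y) \<Longrightarrow> of_nat (card P) \<le> M y"
proof
  \<comment> \<open>The \<open>2 * n * R + 1\<close> cells \<open>D n k\<close> start at the
    multiples of \<open>1/n\<close> in \<open>[-R, R]\<close>. The last one,
    \<open>[R, R + 1/n]\<close>, sticks out, which is why \<open>g\<close> is taken on an interval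
    reaching to \<open>R + 1\<close>.\<close>
  define K where "K n = {- int (n * R)..int (n * R)}" for n
  define D where "D n k = {real_of_int k / real n..(real_of_int k + 1) / real n}" for n k
  define N :: "nat \<Rightarrow> real \<Rightarrow> ennreal" where "N n y = (\<Sum>k\<in>K n. indicator (g ` D n k) y)" for n y
  have L: "L \<ge> 0" using g lipschitz_on_nonneg by blast
  have D: "D n k \<subseteq> {- real R..real R + 1}" if "k \<in> K n" "n \<ge> 1" for n k
  proof -
    have "real_of_int k \<ge> real_of_int (- int (n * R))" "real_of_int k \<le> real_of_int (int (n * R))"
      using that unfolding K_def of_int_le_iff by auto
    then have "- real R \<le> real_of_int k / real n" "real_of_int k / real n \<le> real R"
      using that by (auto simp: field_simps)
    moreover have "(real_of_int k + 1) / real n \<le> real_of_int k / real n + 1"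
      using that by (simp add: field_simps)
    ultimately show ?thesis unfolding D_def by auto
  qed
  have im: "g ` D n k \<in> sets borel" "emeasure lborel (g ` D n k) \<le> ennreal (2 * L / real n)"
    if "k \<in> K n" "n \<ge> 1" for n k
  proof -
    have "compact (g ` D n k)"
      by (rule compact_continuous_image)
        (use lipschitz_on_continuous_on[OF lipschitz_on_subset[OF g D[OF that]]] in \<open>auto simp: D_def\<close>)
    then show "g ` D n k \<in> sets borel" by (rule borel_compact)
    have "g ` D n k \<subseteq> {g (real_of_int k / real n) - L / real n..g (real_of_int k / real n) + L / real n}"
    proof
      fix y assume "y \<in> g ` D n k"
      then obtain t where t: "t \<in> D n k" "y = g t" by blast
      have c: "real_of_int k / real n \<in> D n k" using that by (simp add: D_def divide_right_mono)
      have "dist (g t) (g (real_of_int k / real n)) \<le> L * dist t (real_of_int k / real n)"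
        by (rule lipschitz_onD[OF g]) (use D[OF that] t c in auto)
      also have "\<dots> \<le> L * (1 / real n)"
        using t L by (intro mult_left_mono) (auto simp: D_def dist_real_def add_divide_distrib)
      finally show "y \<in> {g (real_of_int k / real n) - L / real n..g (real_of_int k / real n) + L / real n}"
        by (auto simp: t dist_real_def)
    qed
    then have "emeasure lborel (g ` D n k) \<le>
       emeasure lborel {g (real_of_int k / real n) - L / real n..g (real_of_int k / real n) + L / real n}"
      by (rule emeasure_mono) simp
    also have "\<dots> = ennreal (2 * L / real n)"
      using L by simp
    finally show "emeasure lborel (g ` D n k) \<le> ennreal (2 * L / real n)" .
  qed
  have meas: "N n \<in> borel_measurable borel" if "n \<ge> 1" for n
    unfolding N_def using im(1) that by (intro borel_measurable_sum borel_measurable_indicator) auto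
  \<comment> \<open>There are \<open>2nR + 1\<close> cells with images of length at most
    \<open>2L/n\<close>, so the integrals are bounded independently of \<open>n\<close>.\<close>
  have int: "(\<integral>\<^sup>+y. N n y \<partial>lborel) \<le> ennreal ((2 * real R + 1) * (2 * L))" if "n \<ge> 1" for n
  proof -
    have "(\<integral>\<^sup>+y. N n y \<partial>lborel) = (\<Sum>k\<in>K n. emeasure lborel (g ` D n k))"
      unfolding N_def using im(1) that by (subst nn_integral_sum) auto
    also have "\<dots> \<le> (\<Sum>k\<in>K n. ennreal (2 * L / real n))"
      by (intro sum_mono im) (use that in auto)
    also have "\<dots> = ennreal (\<Sum>k\<in>K n. 2 * L / real n)"
      using L by (intro sum_ennreal) auto
    also have "(\<Sum>k\<in>K n. 2 * L / real n) = (2 * (real n * real R) + 1) * (2 * L / real n)"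
      by (simp add: K_def)
    also have "\<dots> = 2 * real R * (2 * L) + (2 * L) / real n"
      using that by (simp add: field_simps)
    also have "\<dots> \<le> 2 * real R * (2 * L) + (2 * L) / 1"
      using that L by (intro add_left_mono divide_left_mono) auto
    also have "\<dots> = (2 * real R + 1) * (2 * L)"
      by (simp add: algebra_simps)
    finally show ?thesis by (simp add: ennreal_leI)
  qed
  \<comment> \<open>\<open>Suc n\<close> avoids the meaningless mesh \<open>1/0\<close>.\<close>
  let ?M = "\<lambda>y. liminf (\<lambda>n. N (Suc n) y)"
  show "?M \<in> borel_measurable borel"
    by (intro borel_measurable_liminf meas) simp
  have "(\<integral>\<^sup>+y. ?M y \<partial>lborel) \<le> liminf (\<lambda>n. \<integral>\<^sup>+y. N (Suc n) y \<partial>lborel)"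
    using meas by (intro nn_integral_liminf) simp
  also have "\<dots> \<le> ennreal ((2 * real R + 1) * (2 * L))"
    using int by (intro Liminf_le always_eventually) auto
  finally show "(\<integral>\<^sup>+y. ?M y \<partial>lborel) < \<infinity>"
    by (simp add: order_le_less_trans)
  fix P y assume P: "finite P" "P \<subseteq> {- real R<..<real R}" and gP: "\<And>t. t \<in> P \<Longrightarrow> g t = y"
  have "\<forall>\<^sub>F n in sequentially. of_nat (card P) \<le> N (Suc n) y"
    using eventually_compose_filterlim[OF finite_points_in_distinct_cells[OF P(1)] filterlim_Suc]
  proof (rule eventually_mono)
    fix n assume inj: "inj_on (\<lambda>t. \<lfloor>t * real (Suc n)\<rfloor>) P" (is "inj_on ?i P")
    \<comment> \<open>Each point of the fibre selects the cell containing it. By \<open>inj\<close>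
      these cells are distinct, so at least \<open>card P\<close> cells have \<open>y\<close> in
      their image.\<close>
    have "?i ` P \<subseteq> {k \<in> K (Suc n). y \<in> g ` D (Suc n) k}"
    proof safe
      fix t assume t: "t \<in> P"
      then have b: "- real R < t" "t < real R" using P by auto
      have "- real R * real (Suc n) \<le> t * real (Suc n)" "t * real (Suc n) \<le> real R * real (Suc n)"
        using b by (intro mult_right_mono; simp)+
      then have "real_of_int (- int (Suc n * R)) \<le> t * real (Suc n)"
        "t * real (Suc n) < real_of_int (int (Suc n * R) + 1)"
        by (simp_all add: algebra_simps)
      then show "\<lfloor>t * real (Suc n)\<rfloor> \<in> K (Suc n)"
        unfolding K_def atLeastAtMost_iff
        by (metis floor_less_iff le_floor_iff zle_add1_eq_le)
      have "t \<in> D (Suc n) \<lfloor>t * real (Suc n)\<rfloor>"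
        unfolding D_def atLeastAtMost_iff
        by (subst pos_divide_le_eq, simp, subst pos_le_divide_eq, simp) linarith
      then show "y \<in> g ` D (Suc n) \<lfloor>t * real (Suc n)\<rfloor>"
        using gP[OF t] by blast
    qed
    moreover have "finite {k \<in> K (Suc n). y \<in> g ` D (Suc n) k}"
      by (rule finite_subset[of _ "K (Suc n)"]) (auto simp: K_def)
    ultimately have "card P \<le> card {k \<in> K (Suc n). y \<in> g ` D (Suc n) k}"
      unfolding card_image[OF inj, symmetric] by (intro card_mono)
    also have "of_nat (card {k \<in> K (Suc n). y \<in> g ` D (Suc n) k}) = N (Suc n) y"
      unfolding N_def by (simp add: indicator_def K_def sum.If_cases Int_def flip: sum.inter_filter)
    finally show "of_nat (card P) \<le> N (Suc n) y" by simp
  qed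
  then show "of_nat (card P) \<le> ?M y"
    by (rule Liminf_bounded)
qed

text \<open>\<open>W\<close> comes from outer regularity of the finite measure with density \<open>M\<close>.\<close>

lemma open_superset_small_variation:
  fixes g :: "real \<Rightarrow> real" and R :: nat
  assumes g: "L-lipschitz_on {- real R..real R + 1} g"
    and B: "hausdorff1 B = 0" and e: "e > 0"
  obtains W where "open W" "B \<subseteq> W"
    "\<And>F. finite F \<Longrightarrow> pairwise disjnt F \<Longrightarrow>
       (\<And>C. C \<in> F \<Longrightarrow> connected C \<and> C \<noteq> {} \<and> C \<subseteq> {- real R<..<real R} \<and> g ` C \<subseteq> W) \<Longrightarrow>
       (\<Sum>C\<in>F. diameter (g ` C)) \<le> e"
proof -
  obtain M :: "real \<Rightarrow> ennreal" where M: "M \<in> borel_measurable borel"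
    "(\<integral>\<^sup>+y. M y \<partial>lborel) < \<infinity>"
    "\<And>P y. finite P \<Longrightarrow> P \<subseteq> {- real R<..<real R} \<Longrightarrow> (\<And>t. t \<in> P \<Longrightarrow> g t = y) \<Longrightarrow> of_nat (card P) \<le> M y"
    using indicatrix_majorant[OF g] by blast
  obtain B' where B': "B' \<in> null_sets lborel" "B \<subseteq> B'"
    using hausdorff1_eq_0_imp_null[OF B] by blast
  let ?\<mu> = "density lborel M"
  have M': "M \<in> borel_measurable lborel" using M(1) by simp
  have fin: "emeasure ?\<mu> (space ?\<mu>) \<noteq> \<infinity>"
    using M(2) M' by (simp add: emeasure_density)
  have "B' \<in> null_sets ?\<mu>"
    using B'(1) M' AE_not_in[OF B'(1)] by (auto simp: null_sets_density_iff elim!: eventually_mono)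
  then have "emeasure ?\<mu> B' < ennreal e" using e by (simp add: null_setsD1)
  moreover have "emeasure ?\<mu> B' = (INF W \<in> {W. B' \<subseteq> W \<and> open W}. emeasure ?\<mu> W)"
    using fin B'(1) by (intro outer_regular) (auto simp: null_sets_def)
  ultimately obtain W where W: "B' \<subseteq> W" "open W" "emeasure ?\<mu> W < ennreal e"
    unfolding INF_less_iff by (metis (mono_tags, lifting) INF_less_iff mem_Collect_eq)
  show ?thesis
  proof (rule that[of W])
    fix F assume F: "finite F" "pairwise disjnt F"
      and C: "\<And>C. C \<in> F \<Longrightarrow> connected C \<and> C \<noteq> {} \<and> C \<subseteq> {- real R<..<real R} \<and> g ` C \<subseteq> W"
    define I where "I C = {Inf (g ` C)<..<Sup (g ` C)}" for C
    have CR: "C \<subseteq> {- real R..real R + 1}" if "C \<in> F" for C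
      using C[OF that] by force
    have cont: "continuous_on C g" if "C \<in> F" for C
      using lipschitz_on_continuous_on[OF lipschitz_on_subset[OF g CR[OF that]]] .
    have bdd: "bounded (g ` C)" if "C \<in> F" for C
    proof -
      have "compact (g ` {- real R..real R + 1})"
        by (intro compact_continuous_image lipschitz_on_continuous_on[OF g]) simp
      then show ?thesis using CR[OF that] by (meson bounded_subset compact_imp_bounded image_mono)
    qed
    have I: "I C \<subseteq> g ` C" if "C \<in> F" for C
    proof
      fix y assume y: "y \<in> I C"
      have ne: "g ` C \<noteq> {}" and con: "connected (g ` C)"
        using C[OF that] cont[OF that] by (auto intro: connected_continuous_image)
      obtain u v where uv: "u \<in> g ` C" "u < y" "v \<in> g ` C" "y < v"
        using y cInf_lessD[OF ne, of y] less_cSupD[OF ne, of y] by (auto simp: I_def)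
      then show "y \<in> g ` C"
        using con unfolding connected_iff_interval by (meson less_imp_le)
    qed
    have le: "Inf (g ` C) \<le> x \<and> x \<le> Sup (g ` C)" if "C \<in> F" "x \<in> g ` C" for C x
      using bdd[OF that(1)] that(2)
      by (auto intro: cInf_lower cSup_upper bounded_imp_bdd_below bounded_imp_bdd_above)
    have diam: "ennreal (diameter (g ` C)) \<le> emeasure lborel (I C)" if "C \<in> F" for C
    proof -
      have "g ` C \<noteq> {}" using C[OF that] by blast
      then have IS: "Inf (g ` C) \<le> Sup (g ` C)" using le[OF that] by (meson all_not_in_conv order_trans)
      have "diameter (g ` C) \<le> Sup (g ` C) - Inf (g ` C)"
      proof (rule diameter_le)
        show "norm (x - y) \<le> Sup (g ` C) - Inf (g ` C)" if "x \<in> g ` C" "y \<in> g ` C" for x y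
          using le[OF \<open>C \<in> F\<close> that(1)] le[OF \<open>C \<in> F\<close> that(2)] by auto
      qed (use IS in auto)
      then show ?thesis using IS by (simp add: I_def ennreal_leI)
    qed
    \<comment> \<open>Every \<open>C\<close> with \<open>y \<in> I C\<close> contains a preimage of
      \<open>y\<close>. Disjointness makes these preimages distinct, so their number is at most
      \<open>M y\<close>; for \<open>y\<close> outside \<open>W\<close> there are none. Integrating
      this inequality bounds the total diameter.\<close>
    have ptw: "(\<Sum>C\<in>F. indicator (I C) y) \<le> M y * indicator W y" for y
    proof -
      let ?G = "{C \<in> F. y \<in> I C}"
      have "\<forall>C\<in>?G. \<exists>t. t \<in> C \<and> g t = y" using I by blast
      then obtain t where t: "\<And>C. C \<in> ?G \<Longrightarrow> t C \<in> C \<and> g (t C) = y" by metis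
      have inj: "inj_on t ?G"
      proof (rule inj_onI, rule ccontr)
        fix C C' assume CC: "C \<in> ?G" "C' \<in> ?G" "t C = t C'" "C \<noteq> C'"
        then have "disjnt C C'" using F(2) by (auto simp: pairwise_def)
        then show False using t[OF CC(1)] t[OF CC(2)] CC(3) by (auto simp: disjnt_def)
      qed
      have "of_nat (card (t ` ?G)) \<le> M y"
      proof (rule M(3))
        show "t ` ?G \<subseteq> {- real R<..<real R}" using t C by blast
        show "g s = y" if "s \<in> t ` ?G" for s using t that by auto
      qed (use F(1) in simp)
      moreover have "(\<Sum>C\<in>F. indicator (I C) y) = (of_nat (card ?G) :: ennreal)"
        using F(1) by (simp add: indicator_def sum.If_cases Int_def flip: sum.inter_filter)
      moreover have "?G = {}" if "y \<notin> W"
        using that I C by blast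
      ultimately show ?thesis
        by (cases "y \<in> W") (simp_all add: card_image[OF inj])
    qed
    have "ennreal (\<Sum>C\<in>F. diameter (g ` C)) = (\<Sum>C\<in>F. ennreal (diameter (g ` C)))"
      using bdd by (simp add: diameter_ge_0)
    also have "\<dots> \<le> (\<Sum>C\<in>F. emeasure lborel (I C))"
      by (intro sum_mono diam)
    also have "\<dots> = (\<integral>\<^sup>+y. (\<Sum>C\<in>F. indicator (I C) y) \<partial>lborel)"
      by (subst nn_integral_sum) (auto simp: I_def)
    also have "\<dots> \<le> (\<integral>\<^sup>+y. M y * indicator W y \<partial>lborel)"
      by (intro nn_integral_mono ptw)
    also have "\<dots> = emeasure ?\<mu> W"
      using W(2) M' by (simp add: emeasure_density)
    also have "\<dots> \<le> ennreal e"
      using W(3) by simp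
    finally show "(\<Sum>C\<in>F. diameter (g ` C)) \<le> e"
      using e by (simp add: ennreal_le_iff)
  qed (use W B' in auto)
qed

lemma hausdorff1_lipschitz_curve_eq_0:
  fixes g :: "real \<Rightarrow> real^'n" and R :: nat
  assumes g: "L-lipschitz_on {- real R..real R + 1} g"
    and T: "T \<subseteq> {- real R<..<real R}"
    and proj: "\<And>j. hausdorff1 ((\<lambda>t. g t $ j) ` T) = 0"
  shows "hausdorff1 (g ` T) = 0"
proof (rule hausdorff1_eq_0I[where 'i = "real set"])
  fix e :: real assume e: "e > 0"
  have gj: "L-lipschitz_on {- real R..real R + 1} (\<lambda>t. g t $ j)" for j
    using g unfolding lipschitz_on_def by (meson dist_vec_nth_le order_trans)
  have e': "e / real CARD('n) > 0" using e by simp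
  have "\<exists>W. open W \<and> (\<lambda>t. g t $ j) ` T \<subseteq> W \<and> (\<forall>F. finite F \<longrightarrow> pairwise disjnt F \<longrightarrow>
       (\<forall>C\<in>F. connected C \<and> C \<noteq> {} \<and> C \<subseteq> {- real R<..<real R} \<and> (\<lambda>t. g t $ j) ` C \<subseteq> W) \<longrightarrow>
       (\<Sum>C\<in>F. diameter ((\<lambda>t. g t $ j) ` C)) \<le> e / real CARD('n))" for j
    using open_superset_small_variation[OF gj[of j] proj[of j] e'] by metis
  then obtain W where W: "\<And>j. open (W j)" "\<And>j. (\<lambda>t. g t $ j) ` T \<subseteq> W j"
    and small: "\<And>j F. finite F \<Longrightarrow> pairwise disjnt F \<Longrightarrow>
       (\<And>C. C\<in>F \<Longrightarrow> connected C \<and> C \<noteq> {} \<and> C \<subseteq> {- real R<..<real R} \<and> (\<lambda>t. g t $ j) ` C \<subseteq> W j) \<Longrightarrow>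
       (\<Sum>C\<in>F. diameter ((\<lambda>t. g t $ j) ` C)) \<le> e / real CARD('n)"
    by metis
  define S where "S = {- real R<..<real R}"
  define V where "V = (\<Inter>j. S \<inter> (\<lambda>t. g t $ j) -` W j)"
  have "continuous_on S (\<lambda>t. g t $ j)" for j
    by (rule continuous_on_subset[OF lipschitz_on_continuous_on[OF gj]]) (auto simp: S_def)
  then have V: "open V"
    unfolding V_def using W(1)
    by (intro open_INT ballI continuous_open_preimage) (auto simp: S_def)
  have VS: "V \<subseteq> S" by (auto simp: V_def)
  have comp: "C \<subseteq> V" "connected C" "C \<noteq> {}" if "C \<in> components V" for C
    using that in_components_subset in_components_connected in_components_nonempty by blast+
  have disj: "disjoint (components V)"
    using pairwise_disjoint_components[of V] by (simp add: pairwise_def disjnt_def)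
  have count: "countable (components V)"
    using V open_components disj by (intro countable_disjoint_open_subsets) auto
  have bdd: "bounded ((\<lambda>t. g t $ j) ` C)" if "C \<subseteq> S" for j C
  proof -
    have "compact ((\<lambda>t. g t $ j) ` {- real R..real R + 1})"
      by (intro compact_continuous_image lipschitz_on_continuous_on[OF gj]) simp
    moreover have "C \<subseteq> {- real R..real R + 1}" using that by (force simp: S_def)
    ultimately show ?thesis by (meson bounded_subset compact_imp_bounded image_mono)
  qed
  have diam: "norm (x - y) \<le> (\<Sum>j\<in>UNIV. diameter ((\<lambda>t. g t $ j) ` C))"
    if "C \<subseteq> S" "x \<in> g ` C" "y \<in> g ` C" for C x y
  proof -
    have "norm (x - y) \<le> (\<Sum>j\<in>UNIV. \<bar>(x - y) $ j\<bar>)" by (rule norm_le_l1_cart)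
    also have "\<dots> \<le> (\<Sum>j\<in>UNIV. diameter ((\<lambda>t. g t $ j) ` C))"
    proof (rule sum_mono)
      fix j
      have "dist (x $ j) (y $ j) \<le> diameter ((\<lambda>t. g t $ j) ` C)"
        using that by (intro diameter_bounded_bound bdd) auto
      then show "\<bar>(x - y) $ j\<bar> \<le> diameter ((\<lambda>t. g t $ j) ` C)"
        by (simp add: dist_real_def)
    qed
    finally show ?thesis .
  qed
  have "(\<Sum>C\<in>F. diameter (g ` C)) \<le> e" if F: "finite F" "F \<subseteq> components V" for F
  proof -
    have "(\<Sum>C\<in>F. diameter (g ` C)) \<le> (\<Sum>C\<in>F. \<Sum>j\<in>UNIV. diameter ((\<lambda>t. g t $ j) ` C))"
    proof (rule sum_mono)
      fix C assume "C \<in> F"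
      then have "C \<subseteq> S" "C \<noteq> {}" using F comp VS by blast+
      then show "diameter (g ` C) \<le> (\<Sum>j\<in>UNIV. diameter ((\<lambda>t. g t $ j) ` C))"
        using diam by (intro diameter_le) auto
    qed
    \<comment> \<open>The small variation bound concerns one coordinate and all components at once,
      so the coordinate sum is moved outside.\<close>
    also have "\<dots> = (\<Sum>j\<in>UNIV. \<Sum>C\<in>F. diameter ((\<lambda>t. g t $ j) ` C))"
      by (rule sum.swap)
    also have "\<dots> \<le> (\<Sum>j\<in>(UNIV :: 'n set). e / real CARD('n))"
    proof (rule sum_mono, rule small)
      show "pairwise disjnt F"
        using F(2) disj by (meson pairwise_subset)
      fix j C assume "C \<in> F"
      then have "C \<in> components V" using F by blast
      note c = comp[OF this]
      then show "connected C \<and> C \<noteq> {} \<and> C \<subseteq> {- real R<..<real R} \<and> (\<lambda>t. g t $ j) ` C \<subseteq> W j"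
        using VS unfolding V_def S_def by blast
    qed (use F in auto)
    also have "\<dots> = e" by simp
    finally show ?thesis .
  qed
  moreover have "bounded (g ` C)" if "C \<in> components V" for C
    using diam[of C] comp(1)[OF that] VS unfolding bounded_two_points dist_norm by blast
  moreover have "g ` T \<subseteq> (\<Union>C\<in>components V. g ` C)"
  proof -
    have "T \<subseteq> V" using W(2) T by (auto simp: V_def S_def)
    then have "T \<subseteq> \<Union>(components V)" by simp
    then show ?thesis by blast
  qed
  ultimately show "\<exists>(I :: real set set) C. countable I \<and> g ` T \<subseteq> (\<Union>i\<in>I. C i) \<and>
      (\<forall>i\<in>I. bounded (C i)) \<and> (\<forall>F. finite F \<and> F \<subseteq> I \<longrightarrow> (\<Sum>i\<in>F. diameter (C i)) \<le> e)"
    using count by (intro exI[of _ "components V"] exI[of _ "\<lambda>C. g ` C"]) auto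
qed

section \<open>Continuously differentiable maps\<close>

lemma C1_onI:
  assumes "\<And>x. x \<in> S \<Longrightarrow> (f has_derivative blinfun_apply (f' x)) (at x)" "continuous_on S f'"
  shows "C1_on f S"
  using assms unfolding C1_on_def by blast

lemma C1_on_imp_continuous_on:
  assumes "C1_on f S"
  shows "continuous_on S f"
  using assms unfolding C1_on_def
  by (meson continuous_at_imp_continuous_on has_derivative_continuous)

lemma C1_on_subset:
  assumes "C1_on f S" "T \<subseteq> S"
  shows "C1_on f T"
  using assms unfolding C1_on_def by (meson continuous_on_subset subsetD)

lemma C1_on_const: "C1_on (\<lambda>x. c) S"
  by (rule C1_onI[where f' = "\<lambda>x. 0"]) (auto simp: zero_blinfun.rep_eq)

lemma C1_on_add:
  assumes "C1_on f S" "C1_on g S"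
  shows "C1_on (\<lambda>x. f x + g x) S"
proof -
  obtain f' g' where
    f': "\<And>x. x \<in> S \<Longrightarrow> (f has_derivative blinfun_apply (f' x)) (at x)" "continuous_on S f'" and
    g': "\<And>x. x \<in> S \<Longrightarrow> (g has_derivative blinfun_apply (g' x)) (at x)" "continuous_on S g'"
    using assms unfolding C1_on_def by blast
  show ?thesis
  proof (rule C1_onI)
    show "((\<lambda>x. f x + g x) has_derivative blinfun_apply (f' x + g' x)) (at x)" if "x \<in> S" for x
      unfolding plus_blinfun.rep_eq by (intro has_derivative_add f' g' that)
  qed (intro continuous_intros f' g')
qed

lemma C1_on_sum:
  assumes "\<And>i. i \<in> I \<Longrightarrow> C1_on (f i) S"
  shows "C1_on (\<lambda>x. \<Sum>i\<in>I. f i x) S"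
  using assms by (induction I rule: infinite_finite_induct) (auto intro: C1_on_const C1_on_add)

lemma C1_on_mult:
  fixes f g :: "'a::real_normed_vector \<Rightarrow> real"
  assumes "C1_on f S" "C1_on g S"
  shows "C1_on (\<lambda>x. f x * g x) S"
proof -
  obtain f' g' where
    f': "\<And>x. x \<in> S \<Longrightarrow> (f has_derivative blinfun_apply (f' x)) (at x)" "continuous_on S f'" and
    g': "\<And>x. x \<in> S \<Longrightarrow> (g has_derivative blinfun_apply (g' x)) (at x)" "continuous_on S g'"
    using assms unfolding C1_on_def by blast
  show ?thesis
  proof (rule C1_onI)
    show "((\<lambda>x. f x * g x) has_derivative blinfun_apply (f x *\<^sub>R g' x + g x *\<^sub>R f' x)) (at x)"
      if "x \<in> S" for x
      by (rule has_derivative_eq_rhs[OF has_derivative_mult[OF f'(1)[OF that] g'(1)[OF that]]])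
        (auto simp: plus_blinfun.rep_eq scaleR_blinfun.rep_eq)
  qed (intro continuous_intros f' g' C1_on_imp_continuous_on assms)
qed

lemma C1_on_prod:
  fixes f :: "'i \<Rightarrow> 'a::real_normed_vector \<Rightarrow> real"
  assumes "\<And>i. i \<in> I \<Longrightarrow> C1_on (f i) S"
  shows "C1_on (\<lambda>x. \<Prod>i\<in>I. f i x) S"
  using assms by (induction I rule: infinite_finite_induct) (auto intro: C1_on_const C1_on_mult)

lemma C1_on_bounded_linear:
  assumes "bounded_linear B" "C1_on f S"
  shows "C1_on (\<lambda>x. B (f x)) S"
proof -
  obtain f' where
    f': "\<And>x. x \<in> S \<Longrightarrow> (f has_derivative blinfun_apply (f' x)) (at x)" "continuous_on S f'"
    using assms unfolding C1_on_def by blast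
  show ?thesis
  proof (rule C1_onI)
    show "((\<lambda>x. B (f x)) has_derivative blinfun_apply (Blinfun B o\<^sub>L f' x)) (at x)"
      if "x \<in> S" for x
      by (rule has_derivative_eq_rhs[OF bounded_linear.has_derivative[OF assms(1) f'(1)[OF that]]])
        (auto simp: bounded_linear_Blinfun_apply[OF assms(1)])
  qed (intro continuous_intros f')
qed

text \<open>Covers the substitutions used below: freezing the parameters, and passing from a tuple
  to its \<open>j\<close>-th entry. The inner derivative is constant, so continuity of the composite
  derivative is immediate.\<close>

lemma C1_on_compose_affine:
  assumes B: "bounded_linear B" and f: "C1_on f T" and S: "\<And>x. x \<in> S \<Longrightarrow> a + B x \<in> T"
  shows "C1_on (\<lambda>x. f (a + B x)) S"
proof -
  obtain f' where
    f': "\<And>x. x \<in> T \<Longrightarrow> (f has_derivative blinfun_apply (f' x)) (at x)" "continuous_on T f'"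
    using f unfolding C1_on_def by blast
  have cB: "continuous_on S (\<lambda>x. a + B x)"
    by (intro continuous_intros linear_continuous_on B)
  show ?thesis
  proof (rule C1_onI)
    show "((\<lambda>x. f (a + B x)) has_derivative blinfun_apply (f' (a + B x) o\<^sub>L Blinfun B)) (at x)"
      if "x \<in> S" for x
    proof -
      have "((\<lambda>x. a + B x) has_derivative B) (at x)"
        using has_derivative_add[OF has_derivative_const bounded_linear_imp_has_derivative[OF B]] by simp
      from has_derivative_compose[OF this f'(1)[OF S[OF that]]] show ?thesis
        by (rule has_derivative_eq_rhs) (auto simp: bounded_linear_Blinfun_apply[OF B])
    qed
    show "continuous_on S (\<lambda>x. f' (a + B x) o\<^sub>L Blinfun B)"
      using S by (intro continuous_intros continuous_on_compose2[OF f'(2) cB]) auto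
  qed
qed

lemma C1_on_vec:
  fixes f :: "'a::real_normed_vector \<Rightarrow> 'i::finite \<Rightarrow> real"
  assumes "\<And>i. C1_on (\<lambda>x. f x i) S"
  shows "C1_on (\<lambda>x. \<chi> i. f x i) S"
proof -
  have "(\<lambda>x. \<chi> i. f x i) = (\<lambda>x. \<Sum>i\<in>UNIV. f x i *\<^sub>R axis i 1)"
    by (auto simp: vec_eq_iff axis_def if_distrib cong: if_cong)
  then show ?thesis
    by (auto intro!: C1_on_sum C1_on_bounded_linear[OF bounded_linear_scaleR_left] assms)
qed

lemma C1_on_Pair:
  assumes "C1_on f S" "C1_on g S"
  shows "C1_on (\<lambda>x. (f x, g x)) S"
proof -
  have "C1_on (\<lambda>x. (f x, 0) + (0, g x)) S"
    by (intro C1_on_add C1_on_bounded_linear[where B = "\<lambda>y. (y, 0)"]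
        C1_on_bounded_linear[where B = "\<lambda>y. (0, y)"] assms
        bounded_linear_Pair bounded_linear_ident bounded_linear_zero)
  then show ?thesis by simp
qed

lemma C1_on_det:
  fixes A :: "'a::real_normed_vector \<Rightarrow> real^'n^'n"
  assumes "\<And>i j. C1_on (\<lambda>x. A x $ i $ j) S"
  shows "C1_on (\<lambda>x. det (A x)) S"
  unfolding det_def
  by (intro C1_on_sum C1_on_mult C1_on_const C1_on_prod assms)

section \<open>Upper and lower Lipschitz bounds from the derivative\<close>

lemma C1_on_imp_lipschitz_on:
  assumes f: "C1_on f S" and S: "compact S" "convex S"
  obtains L where "L-lipschitz_on S f"
proof -
  obtain f' where
    f': "\<And>x. x \<in> S \<Longrightarrow> (f has_derivative blinfun_apply (f' x)) (at x)" "continuous_on S f'"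
    using f unfolding C1_on_def by blast
  have "bounded (f' ` S)"
    by (intro compact_imp_bounded compact_continuous_image f' S)
  then obtain L where L: "L > 0" "\<And>x. x \<in> S \<Longrightarrow> norm (f' x) \<le> L"
    unfolding bounded_pos by auto
  have "L-lipschitz_on S f"
  proof (rule bounded_derivative_imp_lipschitz[OF _ S(2)])
    show "(f has_derivative blinfun_apply (f' x)) (at x within S)" if "x \<in> S" for x
      using f'(1)[OF that] by (rule has_derivative_at_withinI)
  qed (use L in \<open>auto simp: norm_blinfun.rep_eq\<close>)
  then show ?thesis by (rule that)
qed

text \<open>An injective linear map in finite dimension satisfies
  \<open>B * norm v \<le> norm (D v)\<close> with \<open>B > 0\<close>. On a small ball the
  derivative stays within \<open>B / 2\<close> of \<open>D\<close>, so by the mean value inequality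
  \<open>f - D\<close> is \<open>B / 2\<close>-Lipschitz there, and \<open>B / 2\<close> of the
  lower bound survives.\<close>

lemma C1_on_immersion_lower_lipschitz:
  fixes f :: "'a::euclidean_space \<Rightarrow> 'b::euclidean_space"
  assumes f: "C1_on f S" and S: "open S" "x \<in> S"
    and D: "(f has_derivative D) (at x)" and inj: "\<And>v. v \<noteq> 0 \<Longrightarrow> D v \<noteq> 0"
  shows "\<exists>c>0. \<exists>W. open W \<and> x \<in> W \<and> (\<forall>y\<in>W. \<forall>z\<in>W. c * dist y z \<le> dist (f y) (f z))"
proof -
  obtain f' where
    f': "\<And>x. x \<in> S \<Longrightarrow> (f has_derivative blinfun_apply (f' x)) (at x)" "continuous_on S f'"
    using f unfolding C1_on_def by blast
  have D_eq: "D = blinfun_apply (f' x)"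
    by (rule has_derivative_unique[OF D f'(1)[OF S(2)]])
  have "linear D" using D by (rule has_derivative_linear)
  then have "inj D" using inj by (auto simp: linear_injective_0)
  then obtain B where B: "B > 0" "\<And>v. B * norm v \<le> norm (D v)"
    using linear_inj_bounded_below_pos[OF \<open>linear D\<close>] by metis
  have "isCont f' x" using f'(2) S continuous_on_eq_continuous_at by blast
  then have "\<forall>\<^sub>F y in at x. dist (f' y) (f' x) < B / 2"
    using B(1) half_gt_zero unfolding isCont_def tendsto_iff by blast
  then have "\<forall>\<^sub>F y in nhds x. dist (f' y) (f' x) < B / 2"
    using B(1) by (simp add: eventually_nhds_conv_at)
  moreover have "\<forall>\<^sub>F y in nhds x. y \<in> S" using S by (rule eventually_nhds_in_open)
  ultimately have "\<forall>\<^sub>F y in nhds x. dist (f' y) (f' x) < B / 2 \<and> y \<in> S"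
    by (rule eventually_conj)
  then obtain r where r: "r > 0" "\<And>y. dist y x < r \<Longrightarrow> dist (f' y) (f' x) < B / 2 \<and> y \<in> S"
    unfolding eventually_nhds_metric by blast
  show ?thesis
  proof (intro exI[of _ "B / 2"] exI[of _ "ball x r"] conjI ballI)
    fix y z assume yz: "y \<in> ball x r" "z \<in> ball x r"
    have "norm (f y - f z - f' x (y - z)) \<le> norm (y - z) * (B / 2)"
    proof (rule differentiable_bound_linearization[where S = "ball x r" and f' = "\<lambda>x. blinfun_apply (f' x)"])
      show "z + t *\<^sub>R (y - z) \<in> ball x r" if "t \<in> {0..1}" for t
      proof -
        have "(1 - t) *\<^sub>R z + t *\<^sub>R y \<in> ball x r"
          using yz that by (intro convexD[OF convex_ball]) auto
        then show ?thesis by (simp add: algebra_simps)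
      qed
      fix w assume w: "w \<in> ball x r"
      then have w': "dist (f' w) (f' x) < B / 2" "w \<in> S" using r(2) by (auto simp: dist_commute)
      show "(f has_derivative blinfun_apply (f' w)) (at w within ball x r)"
        using f'(1)[OF w'(2)] by (rule has_derivative_at_withinI)
      have "onorm (blinfun_apply (f' w) - blinfun_apply (f' x)) = norm (f' w - f' x)"
        by (simp add: norm_blinfun.rep_eq minus_blinfun.rep_eq fun_diff_def)
      then show "onorm (blinfun_apply (f' w) - blinfun_apply (f' x)) \<le> B / 2"
        using w'(1) by (simp add: dist_norm)
    qed (use r in auto)
    moreover have "B * norm (y - z) \<le> norm (f' x (y - z))" using B(2) D_eq by simp
    moreover have "norm (f' x (y - z)) \<le> norm (f y - f z - f' x (y - z)) + norm (f y - f z)"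
      using norm_triangle_ineq4[of "f y - f z" "f y - f z - f' x (y - z)"] by simp
    ultimately show "B / 2 * dist y z \<le> dist (f y) (f z)"
      by (simp add: dist_norm mult.commute)
  qed (use B r in auto)
qed

section \<open>Rectifiable sets and fold maps\<close>

text \<open>Up to a null set, \<open>S\<close> lies on Lipschitz curves \<open>f i\<close>. The
  curves \<open>H \<circ> f i\<close> have null coordinate projections over the parameters landing
  in \<open>S\<close>, so the corresponding parts of \<open>H\<close>
  S\<open>are null; the inverse of\<close>H\<open>on\<close>H \<open>S\<close> is
  \<open>1 / c\<close>-Lipschitz and carries this back to \<open>S\<close>.\<close>

lemma hausdorff1_eq_0_of_projections:
  fixes H :: "real^'n \<Rightarrow> real^'n"
  assumes H: "C1_on H UNIV" and E: "rectifiable1 E" "S \<subseteq> E"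
    and proj: "\<And>j. hausdorff1 ((\<lambda>x. H x $ j) ` S) = 0"
    and c: "c > 0" "\<And>y z. y \<in> S \<Longrightarrow> z \<in> S \<Longrightarrow> c * dist y z \<le> dist (H y) (H z)"
  shows "hausdorff1 S = 0"
proof -
  obtain f :: "nat \<Rightarrow> real \<Rightarrow> real^'n" where
    f: "\<And>i. \<exists>L. L-lipschitz_on UNIV (f i)" and N: "hausdorff1 (E - (\<Union>i. range (f i))) = 0"
    using E(1) unfolding rectifiable1_def by blast
  \<comment> \<open>\<open>H\<close> is Lipschitz only on bounded sets, so the parameters are cut
    into bounded ranges.\<close>
  define T where "T i R = {t \<in> {- real R<..<real R}. f i t \<in> S}" for i R :: nat
  have piece: "hausdorff1 (f i ` T i R) = 0" for i R
  proof -
    obtain L where L: "L-lipschitz_on UNIV (f i)" using f by blast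
    have "compact (f i ` {- real R..real R + 1})"
      by (intro compact_continuous_image continuous_on_subset[OF lipschitz_on_continuous_on[OF L]]) auto
    \<comment> \<open>A ball is convex as well as compact, as the derivative bound for
      \<open>H\<close> requires.\<close>
    then obtain r where "\<forall>x\<in>f i ` {- real R..real R + 1}. norm x \<le> r"
      using compact_imp_bounded bounded_iff by metis
    then have r: "f i ` {- real R..real R + 1} \<subseteq> cball 0 r"
      by auto
    obtain M where M: "M-lipschitz_on (cball 0 r) H"
      using C1_on_imp_lipschitz_on[OF C1_on_subset[OF H subset_UNIV] compact_cball convex_cball] by blast
    have "(M * L)-lipschitz_on {- real R..real R + 1} (\<lambda>t. H (f i t))"
      by (rule lipschitz_on_compose2[OF lipschitz_on_subset[OF L subset_UNIV] lipschitz_on_subset[OF M r]])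
    then have "hausdorff1 ((\<lambda>t. H (f i t)) ` T i R) = 0"
    proof (rule hausdorff1_lipschitz_curve_eq_0)
      show "hausdorff1 ((\<lambda>t. H (f i t) $ j) ` T i R) = 0" for j
        by (rule hausdorff1_eq_0_subset[OF proj[of j]]) (auto simp: T_def)
    qed (auto simp: T_def)
    moreover have "(1 / c)-lipschitz_on ((\<lambda>t. H (f i t)) ` T i R) (inv_into S H)"
    proof (rule lipschitz_onI)
      fix u v assume "u \<in> (\<lambda>t. H (f i t)) ` T i R" "v \<in> (\<lambda>t. H (f i t)) ` T i R"
      then have "u \<in> H ` S" "v \<in> H ` S" by (auto simp: T_def)
      then show "dist (inv_into S H u) (inv_into S H v) \<le> 1 / c * dist u v"
        using c(2)[of "inv_into S H u" "inv_into S H v"] c(1) inv_into_into[of _ H S]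
        by (simp add: f_inv_into_f field_simps)
    qed (use c in auto)
    ultimately have "hausdorff1 (inv_into S H ` (\<lambda>t. H (f i t)) ` T i R) = 0"
      by (rule hausdorff1_lipschitz_image_eq_0)
    moreover have "inj_on H S"
    proof (rule inj_onI)
      fix y z assume "y \<in> S" "z \<in> S" "H y = H z"
      then have "c * dist y z \<le> 0" using c(2)[of y z] by simp
      then show "y = z" using c(1) by (simp add: mult_le_0_iff)
    qed
    then have "inv_into S H ` (\<lambda>t. H (f i t)) ` T i R = f i ` T i R"
      by (force simp: image_image T_def intro!: image_cong)
    ultimately show ?thesis by simp
  qed
  have "hausdorff1 (\<Union>(i, R)\<in>UNIV. f i ` T i R) = 0"
    by (rule hausdorff1_eq_0_UN) (auto simp: piece)
  moreover have "S \<subseteq> (E - (\<Union>i. range (f i))) \<union> (\<Union>(i, R)\<in>UNIV. f i ` T i R)"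
  proof
    fix x assume x: "x \<in> S"
    show "x \<in> (E - (\<Union>i. range (f i))) \<union> (\<Union>(i, R)\<in>UNIV. f i ` T i R)"
    proof (cases "x \<in> (\<Union>i. range (f i))")
      case True
      then obtain i t where t: "x = f i t" by blast
      obtain R :: nat where "\<bar>t\<bar> < real R" using reals_Archimedean2 by blast
      then have "t \<in> T i R" using x t by (auto simp: T_def)
      then show ?thesis using t by auto
    qed (use x E in auto)
  qed
  ultimately show ?thesis
    using hausdorff1_eq_0_Un[OF N] hausdorff1_eq_0_subset by blast
qed

text \<open>Here \<open>J\<close> plays the Jacobian determinant, known only through
  \<open>regular\<close> and \<open>fold\<close>. Both halves of \<open>E\<close> are treated
  locally through a lower Lipschitz bound, for \<open>H\<close> where \<open>J \<noteq> 0\<close>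
  and for \<open>(H, J)\<close> where \<open>J = 0\<close>.\<close>

lemma hausdorff1_eq_0_of_fold:
  fixes H :: "real^'n \<Rightarrow> real^'n" and J :: "real^'n \<Rightarrow> real"
  assumes H: "C1_on H UNIV" and J: "C1_on J UNIV"
    and H': "\<And>x. (H has_derivative H' x) (at x)" and J': "\<And>x. (J has_derivative J' x) (at x)"
    and regular: "\<And>x v. J x \<noteq> 0 \<Longrightarrow> v \<noteq> 0 \<Longrightarrow> H' x v \<noteq> 0"
    and fold: "\<And>x v. x \<in> E \<Longrightarrow> v \<noteq> 0 \<Longrightarrow> H' x v = 0 \<Longrightarrow> J' x v \<noteq> 0"
    and E: "rectifiable1 E"
    and proj: "\<And>j. hausdorff1 ((\<lambda>x. H x $ j) ` E) = 0"
  shows "hausdorff1 E = 0"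
proof -
  have local: "hausdorff1 (S \<inter> W) = 0" if "S \<subseteq> E" "c > 0"
    "\<And>y z. y \<in> S \<inter> W \<Longrightarrow> z \<in> S \<inter> W \<Longrightarrow> c * dist y z \<le> dist (H y) (H z)" for S W c
  proof (rule hausdorff1_eq_0_of_projections[OF H E _ _ that(2,3)])
    show "hausdorff1 ((\<lambda>x. H x $ j) ` (S \<inter> W)) = 0" for j
      by (rule hausdorff1_eq_0_subset[OF proj[of j]]) (use that(1) in blast)
  qed (use that(1) in auto)
  have "hausdorff1 (E \<inter> {x. J x \<noteq> 0}) = 0"
  proof (rule hausdorff1_eq_0_locally)
    fix x assume x: "x \<in> E \<inter> {x. J x \<noteq> 0}"
    have "H' x v \<noteq> 0" if "v \<noteq> 0" for v
      using regular[of x v] x that by auto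
    from C1_on_immersion_lower_lipschitz[OF H open_UNIV UNIV_I H' this]
    obtain c W where "c > 0" "open W" "x \<in> W"
      "\<And>y z. y \<in> W \<Longrightarrow> z \<in> W \<Longrightarrow> c * dist y z \<le> dist (H y) (H z)" by blast
    then show "\<exists>W. open W \<and> x \<in> W \<and> hausdorff1 (E \<inter> {x. J x \<noteq> 0} \<inter> W) = 0"
      by (intro exI[of _ W] conjI local[of _ c]) auto
  qed
  moreover have "hausdorff1 (E \<inter> {x. J x = 0}) = 0"
  proof (rule hausdorff1_eq_0_locally)
    fix x assume x: "x \<in> E \<inter> {x. J x = 0}"
    have HJ: "((\<lambda>x. (H x, J x)) has_derivative (\<lambda>v. (H' x v, J' x v))) (at x)"
      by (intro has_derivative_Pair H' J')
    have "(H' x v, J' x v) \<noteq> 0" if "v \<noteq> 0" for v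
      using fold[of x v] x that by (auto simp: zero_prod_def)
    from C1_on_immersion_lower_lipschitz[OF C1_on_Pair[OF H J] open_UNIV UNIV_I HJ this]
    obtain c W where W: "c > 0" "open W" "x \<in> W"
      "\<And>y z. y \<in> W \<Longrightarrow> z \<in> W \<Longrightarrow> c * dist y z \<le> dist (H y, J y) (H z, J z)" by blast
    \<comment> \<open>On \<open>{J = 0}\<close> the second components agree, so the bound for the
      pair is a bound for \<open>H\<close> alone.\<close>
    have "c * dist y z \<le> dist (H y) (H z)"
      if "y \<in> E \<inter> {x. J x = 0} \<inter> W" "z \<in> E \<inter> {x. J x = 0} \<inter> W" for y z
      using W(4)[of y z] that by (simp add: dist_Pair_Pair)
    with W show "\<exists>W. open W \<and> x \<in> W \<and> hausdorff1 (E \<inter> {x. J x = 0} \<inter> W) = 0"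
      by (intro exI[of _ W] conjI local[of _ c]) auto
  qed
  ultimately have "hausdorff1 (E \<inter> {x. J x \<noteq> 0} \<union> E \<inter> {x. J x = 0}) = 0"
    by (rule hausdorff1_eq_0_Un)
  moreover have "E \<inter> {x. J x \<noteq> 0} \<union> E \<inter> {x. J x = 0} = E" by blast
  ultimately show ?thesis by simp
qed

section \<open>Stability of the fold condition and choice of the neighbourhoods\<close>

theorem theorem1p6:
  fixes A :: "(real^'m) set"
    and \<phi> :: "real^'m \<Rightarrow> real^'d \<Rightarrow> real"
    and \<alpha>0 :: "'d \<Rightarrow> real^'m"
    and K U :: "(real^'d) set"
  assumes "CARD('d) \<ge> 2"
    and "open A"
    and "C2_on (\<lambda>(\<alpha>, x). \<phi> \<alpha> x) (A \<times> UNIV)"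
    and "\<forall>j. \<alpha>0 j \<in> A"
    and "compact K" and "open U" and "K \<subseteq> U"
    and "\<forall>x \<in> critical_set (encoding_map \<phi> \<alpha>0) \<inter> closure U.
           fold_nondegenerate_at (encoding_map \<phi> \<alpha>0) x"
  shows "\<exists>V :: 'd \<Rightarrow> (real^'m) set.
           (\<forall>j. open (V j) \<and> \<alpha>0 j \<in> V j \<and> V j \<subseteq> A) \<and>
           (\<forall>E. rectifiable1 E \<and> E \<subseteq> K \<and> hausdorff1 E > 0 \<longrightarrow>
              (\<exists>j. \<forall>\<alpha> \<in> V j. hausdorff1 (\<phi> \<alpha> ` E) > 0))"
proof -
  define \<Phi> where "\<Phi> = (\<lambda>(\<alpha>, x). \<phi> \<alpha> x)"
  obtain \<Phi>' :: "(real^'m) \<times> (real^'d) \<Rightarrow> ((real^'m) \<times> (real^'d)) \<Rightarrow>\<^sub>L real" where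
    \<Phi>': "\<And>z. z \<in> A \<times> UNIV \<Longrightarrow> (\<Phi> has_derivative blinfun_apply (\<Phi>' z)) (at z)" and
    C1: "C1_on \<Phi>' (A \<times> UNIV)"
    using assms(3) unfolding C2_on_def \<Phi>_def by blast
  have cont\<Phi>': "continuous_on (A \<times> UNIV) \<Phi>'"
    using C1 by (rule C1_on_imp_continuous_on)
  have C1\<Phi>: "C1_on \<Phi> (A \<times> UNIV)"
    using \<Phi>' cont\<Phi>' by (rule C1_onI)
  \<comment> \<open>Tuples are stored as vectors, so that one can differentiate jointly in tuple and
    point and use the product topology.\<close>
  define Q where "Q = {p :: (real^'m)^'d. \<forall>j. p $ j \<in> A}"
  have openQ: "open Q"
  proof -
    have "Q = (\<Inter>j. (\<lambda>p. p $ j) -` A)" by (auto simp: Q_def)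
    then show ?thesis
      using assms(2) by (auto intro!: open_INT open_vimage continuous_intros)
  qed
  \<comment> \<open>The direction \<open>(0, v)\<close> leaves the parameter fixed:
    \<open>D p x\<close> is the spatial derivative of the encoding map of \<open>p\<close>, and
    \<open>M p x\<close> is its matrix.\<close>
  define D where "D p x v = (\<chi> j. \<Phi>' (p $ j, x) (0, v))" for p :: "(real^'m)^'d" and x v
  define M where "M p x = (\<chi> j i. \<Phi>' (p $ j, x) (0, axis i 1))" for p :: "(real^'m)^'d" and x
  have lin: "bounded_linear (\<lambda>v :: real^'d. (0 :: real^'m, v))"
    by (intro bounded_linear_Pair bounded_linear_zero bounded_linear_ident)
  have linD: "linear (D p x)" for p x
  proof (rule linearI)
    have L: "linear (\<lambda>v. \<Phi>' (p $ i, x) (0, v))" for i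
      by (rule bounded_linear.linear[OF bounded_linear_compose[OF blinfun.bounded_linear_right lin]])
    show "D p x (v + w) = D p x v + D p x w" for v w
      using linear_add[OF L] by (simp add: D_def vec_eq_iff)
    show "D p x (c *\<^sub>R v) = c *\<^sub>R D p x v" for c v
      using linear_scale[OF L] by (simp add: D_def vec_eq_iff)
  qed
  have M_eq: "M p x = matrix (D p x)" for p x
    by (simp add: M_def D_def matrix_def)
  have MD: "M p x *v v = D p x v" for p x v
    unfolding M_eq by (simp add: linD)
  have derH: "(encoding_map \<phi> (\<lambda>j. p $ j) has_derivative D p x) (at x)" if "p \<in> Q" for p x
  proof (subst has_derivative_componentwise_within, rule ballI)
    fix b :: "real^'d" assume "b \<in> Basis"
    then obtain j where b: "b = axis j 1" by (auto simp: Basis_vec_def)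
    have "((\<lambda>x. (p $ j, x)) has_derivative (\<lambda>v. (0, v))) (at x)"
      by (intro has_derivative_Pair has_derivative_const has_derivative_ident)
    from has_derivative_compose[OF this \<Phi>'[of "(p $ j, x)"]] that
    show "((\<lambda>x. encoding_map \<phi> (($) p) x \<bullet> b) has_derivative (\<lambda>v. D p x v \<bullet> b)) (at x)"
      by (simp add: Q_def \<Phi>_def b encoding_map_def D_def inner_axis)
  qed
  have jac: "jacobian (encoding_map \<phi> (\<lambda>j. p $ j)) (at x) = M p x" if "p \<in> Q" for p x
    using frechet_derivative_at[OF derH[OF that]] by (simp add: jacobian_def M_eq)
  define J where "J = (\<lambda>(p, x). det (M p x))"
  \<comment> \<open>The entries of \<open>M\<close> are first derivatives of \<open>\<phi>\<close>,
    so they are jointly \<open>C^1\<close>; hence so is their determinant \<open>J\<close>.\<close>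
  have "C1_on (\<lambda>z. \<Phi>' (fst z $ j, snd z) (0, axis i 1)) (Q \<times> UNIV)" for i j
  proof (rule C1_on_bounded_linear[where B = "\<lambda>F. blinfun_apply F (0, axis i 1)"])
    show "bounded_linear (\<lambda>F :: ((real^'m) \<times> (real^'d)) \<Rightarrow>\<^sub>L real. F (0, axis i 1))"
      by (rule blinfun.bounded_linear_left)
    have "C1_on (\<lambda>z. \<Phi>' (0 + (fst z $ j, snd z))) (Q \<times> UNIV)"
      by (rule C1_on_compose_affine[OF _ C1])
        (auto simp: Q_def intro!: bounded_linear_Pair bounded_linear_snd
          bounded_linear_compose[OF bounded_linear_vec_nth bounded_linear_fst])
    then show "C1_on (\<lambda>z. \<Phi>' (fst z $ j, snd z)) (Q \<times> UNIV)" by simp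
  qed
  then have C1J: "C1_on J (Q \<times> UNIV)"
    unfolding J_def case_prod_beta M_def by (intro C1_on_det) simp
  then obtain J' where
    J': "\<And>z. z \<in> Q \<times> UNIV \<Longrightarrow> (J has_derivative blinfun_apply (J' z)) (at z)" and
    contJ': "continuous_on (Q \<times> UNIV) J'"
    unfolding C1_on_def by blast
  have derJ: "((\<lambda>x. J (p, x)) has_derivative (\<lambda>v. J' (p, x) (0, v))) (at x)" if "p \<in> Q" for p x
  proof -
    have "((\<lambda>x. (p, x)) has_derivative (\<lambda>v. (0, v))) (at x)"
      by (intro has_derivative_Pair has_derivative_const has_derivative_ident)
    from has_derivative_compose[OF this J'[of "(p, x)"]] that show ?thesis by simp
  qed
  \<comment> \<open>\<open>G (p, x, v)\<close> vanishes exactly when \<open>v\<close> is in the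
    kernel of both the derivative of the encoding map and that of \<open>J\<close>. Positivity for
    unit \<open>v\<close> is the quantitative fold condition, and it is open in
    \<open>p\<close>.\<close>
  define G where "G = (\<lambda>(p, x, v). norm (D p x v) + \<bar>J' (p, x) (0, v)\<bar>)"
  have contG: "continuous_on (Q \<times> UNIV) G"
  proof -
    have "continuous_on (Q \<times> UNIV) (\<lambda>z. \<Phi>' (fst z $ j, fst (snd z)))" for j
      by (rule continuous_on_compose2[OF cont\<Phi>']) (auto intro!: continuous_intros simp: Q_def)
    moreover have "continuous_on (Q \<times> UNIV) (\<lambda>z. J' (fst z, fst (snd z)))"
      by (rule continuous_on_compose2[OF contJ']) (auto intro!: continuous_intros)
    ultimately show ?thesis
      unfolding G_def D_def case_prod_beta by (intro continuous_intros)
  qed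
  define p0 where "p0 = (\<chi> j. \<alpha>0 j)"
  have p0: "p0 \<in> Q" and p0_eq: "(\<lambda>j. p0 $ j) = \<alpha>0"
    using assms(4) by (auto simp: p0_def Q_def)
  \<comment> \<open>A nonzero kernel vector makes the rank drop, so \<open>x\<close> is critical,
    and the hypothesis applies since \<open>K \<subseteq> U\<close>.\<close>
  have fold0: "J' (p0, x) (0, v) \<noteq> 0" if "x \<in> K" "v \<noteq> 0" "D p0 x v = 0" for x v
  proof -
    let ?H = "encoding_map \<phi> \<alpha>0"
    have jac0: "jacobian ?H (at y) = M p0 y" for y
      using jac[OF p0, of y] by (simp add: p0_eq)
    have "\<not> inj ((*v) (jacobian ?H (at x)))"
      using that(2,3) unfolding jac0 by (metis MD injD matrix_vector_mult_0_right)
    then have "rank (jacobian ?H (at x)) < CARD('d)"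
      by (simp add: less_rank_noninjective)
    then have "x \<in> critical_set ?H" by (simp add: critical_set_def)
    moreover have "x \<in> closure U" using that(1) assms(7) closure_subset by blast
    ultimately have "fold_nondegenerate_at ?H x" using assms(8) by blast
    then have "frechet_derivative (jacobian_det ?H) (at x) v \<noteq> 0"
      using that(2,3) by (simp add: fold_nondegenerate_at_def jac0 MD)
    moreover have "jacobian_det ?H = (\<lambda>x. J (p0, x))"
      by (simp add: fun_eq_iff jacobian_det_def jac0 J_def)
    ultimately show ?thesis
      using frechet_derivative_at[OF derJ[OF p0, of x]] by metis
  qed
  define W where "W = (Q \<times> UNIV) \<inter> G -` {0<..}"
  have "open W"
    unfolding W_def using contG openQ by (intro continuous_open_preimage open_Times) auto
  moreover have "compact (K \<times> sphere (0 :: real^'d) 1)"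
    using assms(5) by (intro compact_Times) auto
  moreover have "{p0} \<times> (K \<times> sphere 0 1) \<subseteq> W"
  proof safe
    fix x v assume x: "x \<in> K" and v: "v \<in> sphere (0 :: real^'d) 1"
    then have "v \<noteq> 0" by auto
    then have "D p0 x v \<noteq> 0 \<or> J' (p0, x) (0, v) \<noteq> 0" using fold0[OF x] by blast
    then have "G (p0, x, v) > 0"
      by (auto simp: G_def add_pos_nonneg add_nonneg_pos)
    then show "(p0, x, v) \<in> W" using p0 by (simp add: W_def)
  qed
  \<comment> \<open>The tube lemma over the compact set of points of \<open>K\<close> and unit
    vectors gives one neighbourhood of \<open>p0\<close> serving all of them.\<close>
  ultimately obtain X where X: "p0 \<in> X" "open X" "X \<times> (K \<times> sphere 0 1) \<subseteq> W"
    using Elementary_Topology.tube_lemma[of "K \<times> sphere (0 :: real^'d) 1" W p0] by blast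
  \<comment> \<open>A box around \<open>p0\<close> inside \<open>X\<close> makes the parameters
    independently selectable. It is fixed before \<open>E\<close> is given.\<close>
  obtain V0 where V0: "\<And>j. open (V0 j)" "\<And>j. p0 $ j \<in> V0 j" "\<And>p. (\<And>j. p $ j \<in> V0 j) \<Longrightarrow> p \<in> X"
    using X(1,2) unfolding open_vec_def by metis
  define V where "V j = V0 j \<inter> A" for j
  have V: "open (V j)" "\<alpha>0 j \<in> V j" "V j \<subseteq> A" for j
    using V0(1,2)[of j] assms(2,4) by (auto simp: V_def p0_def)
  have "\<exists>j. \<forall>\<alpha>\<in>V j. hausdorff1 (\<phi> \<alpha> ` E) > 0"
    if E: "rectifiable1 E" "E \<subseteq> K" "hausdorff1 E > 0" for E
  proof (rule ccontr)
    assume "\<not> (\<exists>j. \<forall>\<alpha>\<in>V j. hausdorff1 (\<phi> \<alpha> ` E) > 0)"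
    then have "\<forall>j. \<exists>\<alpha>. \<alpha> \<in> V j \<and> hausdorff1 (\<phi> \<alpha> ` E) = 0"
      by (auto simp: zero_less_iff_neq_zero)
    \<comment> \<open>One bad parameter per index is combined into a single tuple, which still lies
      in the box and so still satisfies the fold condition on \<open>K\<close>.\<close>
    then obtain \<alpha> where \<alpha>: "\<And>j. \<alpha> j \<in> V j" "\<And>j. hausdorff1 (\<phi> (\<alpha> j) ` E) = 0"
      by metis
    define p where "p = (\<chi> j. \<alpha> j)"
    have p: "p \<in> Q" "p \<in> X"
      using \<alpha>(1) V0(3) by (auto simp: p_def Q_def V_def)
    have p_eq: "p $ j = \<alpha> j" for j by (simp add: p_def)
    have "hausdorff1 E = 0"
    proof (rule hausdorff1_eq_0_of_fold[OF _ _ derH[OF p(1)] derJ[OF p(1)]])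
      show "C1_on (encoding_map \<phi> (($) p)) UNIV"
        unfolding encoding_map_def
      proof (rule C1_on_vec)
        fix j
        have "C1_on (\<lambda>x. \<Phi> ((p $ j, 0) + (0, x))) UNIV"
          by (rule C1_on_compose_affine[OF lin C1\<Phi>]) (use p(1) in \<open>simp add: Q_def\<close>)
        then show "C1_on (\<lambda>x. \<phi> (p $ j) x) UNIV" by (simp add: \<Phi>_def)
      qed
      have "C1_on (\<lambda>x. J ((p, 0) + (0, x))) UNIV"
        by (rule C1_on_compose_affine[OF _ C1J])
          (use p(1) in \<open>auto intro!: bounded_linear_Pair bounded_linear_zero bounded_linear_ident\<close>)
      then show "C1_on (\<lambda>x. J (p, x)) UNIV" by simp
      show "D p x v \<noteq> 0" if "J (p, x) \<noteq> 0" "v \<noteq> 0" for x v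
      proof -
        have "invertible (M p x)" using that(1) by (simp add: J_def invertible_det_nz)
        then show ?thesis
          using that(2) unfolding MD[symmetric]
          by (metis inj_matrix_vector_mult injD matrix_vector_mult_0_right)
      qed
      show "J' (p, x) (0, v) \<noteq> 0" if "x \<in> E" "v \<noteq> 0" "D p x v = 0" for x v
      proof
        assume J0: "J' (p, x) (0, v) = 0"
        \<comment> \<open>Both derivatives are homogeneous in \<open>v\<close>, so a common kernel
          vector can be normalised to the unit sphere, where \<open>G\<close> is positive.\<close>
        define u where "u = (1 / norm v) *\<^sub>R v"
        have "(p, x, u) \<in> W"
          using X(3) p(2) that E(2) by (auto simp: u_def)
        moreover have "D p x u = 0"
          unfolding u_def using that(3) by (simp add: linear_scale[OF linD])
        moreover have "J' (p, x) (0, u) = 0"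
          using J0 blinfun.scaleR_right[of "J' (p, x)" "1 / norm v" "(0, v)"] by (simp add: u_def)
        ultimately show False by (simp add: W_def G_def)
      qed
      show "hausdorff1 ((\<lambda>x. encoding_map \<phi> (($) p) x $ j) ` E) = 0" for j
        using \<alpha>(2)[of j] by (simp add: encoding_map_def p_eq)
    qed (rule E(1))
    then show False using E(3) by simp
  qed
  then show ?thesis using V by blast
qed

end
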